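(* Let $\varepsilon_1,\varepsilon_2,\mu_0>0$, $\omega>0$, $k\in\mathbb{R}$, $h_1,h_2>0$, and put $h=h_1+h_2$, $f_1=h_1/h$, $f_2=h_2/h$. For $m=1,2$ let $$\sigma_m=\begin{pmatrix}0&\mu_0\\-\varepsilon_m&0\end{pmatrix},\qquad M_m=\omega\begin{pmatrix}0&\sigma_m+\frac{k^2}{\omega^2}\sigma_m^{-1}\\-\sigma_m&0\end{pmatrix}$$ ($M_m$ is a $4\times4$ matrix in $2\times 2$ blocks). Let $M_{\rm eff}$ be the second-order Baker--Campbell--Hausdorff approximation of $\frac{1}{ih}\log\left(\exp[iM_2h_2]\exp[iM_1h_1]\right)$, i.e. $$M_{\rm eff}=M_1f_1+M_2f_2+\frac{ih}{2}[M_2f_2,M_1f_1]+\frac{h^2}{12}[M_1f_1,[M_2f_2,M_1f_1]]-\frac{h^2}{12}[M_2f_2,[M_2f_2,M_1f_1]].$$ Then $$M_{\rm eff}=\omega\begin{pmatrix}-i\sigma_K'&\sigma_\perp+\frac{k^2}{\omega^2}\sigma_3^{-1}\\-\sigma_\parallel&i\sigma_K\end{pmatrix},$$ where $$\sigma_\parallel=\begin{pmatrix}0&\mu_\parallel\\-\varepsilon_\parallel&0\end{pmatrix},\quad \sigma_\perp=\begin{pmatrix}0&\mu_\perp\\-\varepsilon_\perp&0\end{pmatrix},\quad \sigma_3^{-1}=\begin{pmatrix}0&-\varepsilon_3^{-1}\\ \mu_3^{-1}&0\end{pmatrix},$$ $$\sigma_K=\begin{pmatrix}K_\perp&0\\0&-K_\parallel\end{pmatrix},\quad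 \sigma_K'=\begin{pmatrix}-K_\parallel&0\\0&K_\perp\end{pmatrix},$$ and, with $\gamma=1-\dfrac{k^2}{\omega^2}\dfrac{\varepsilon_1+\varepsilon_2}{\mu_0\varepsilon_1\varepsilon_2}$, $$K_\perp=\tfrac{\omega h}{2}\mu_0(\varepsilon_1-\varepsilon_2)f_1f_2,\qquad K_\parallel=\tfrac{\omega h}{2}\mu_0(\varepsilon_1-\varepsilon_2)f_1f_2\,\gamma,$$ $$\varepsilon_\parallel=\varepsilon_1f_1+\varepsilon_2f_2+\tfrac{\omega^2h^2}{6}\mu_0f_1f_2(\varepsilon_1-\varepsilon_2)(\varepsilon_1f_1-\varepsilon_2f_2)\,\gamma,$$ $$\varepsilon_\perp=\varepsilon_1f_1+\varepsilon_2f_2+\tfrac{\omega^2h^2}{6}\mu_0f_1f_2(\varepsilon_1-\varepsilon_2)(\varepsilon_1f_1-\varepsilon_2f_2),$$ $$\mu_\parallel=\mu_0-\tfrac{\omega^2h^2}{6}\mu_0^2f_1f_2(\varepsilon_1-\varepsilon_2)(f_1-f_2),\qquad \mu_\perp=\mu_0-\tfrac{\omega^2h^2}{6}\mu_0^2f_1f_2(\varepsilon_1-\varepsilon_2)(f_1-f_2)\,\gamma,$$ $$\varepsilon_3^{-1}=\varepsilon_1^{-1}f_1+\varepsilon_2^{-1}f_2-\tfrac{\omega^2h^2}{6}\mu_0f_1f_2(\varepsilon_1-\varepsilon_2)(\varepsilon_1^{-1}f_1-\varepsilon_2^{-1}f_2)\,\gamma,$$ $$\mu_3^{-1}=\mu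_0^{-1}+\tfrac{\omega^2h^2}{6}f_1f_2(\varepsilon_1-\varepsilon_2)(f_1-f_2).$$
   Context: $[X,Y]=XY-YX$ is the matrix commutator and $i$ is the imaginary unit. The numbers $\varepsilon_\parallel,\varepsilon_\perp,\varepsilon_3$ (effective permittivity), $\mu_\parallel,\mu_\perp,\mu_3$ (effective permeability) and $K_\parallel,K_\perp$ (effective magnetoelectric coupling) are the parameters of the effective medium of a periodic stack whose unit cell consists of two dielectric layers of permittivities $\varepsilon_1,\varepsilon_2$, permeability $\mu_0$ and thicknesses $h_1,h_2$; $\omega$ is the frequency and $k$ the in-plane wave number. The symbols $\varepsilon_3^{-1}$ and $\mu_3^{-1}$ are the real numbers defined by the displayed formulas, and $\sigma_3^{-1}$ is the displayed matrix. *)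

theory Defs
  imports "HOL-Analysis.Analysis"
begin

text \<open>Scalar multiplication of a matrix by an arbitrary (here: complex) scalar;
  the library only provides the real one, \<open>(*\<^sub>R)\<close>.\<close>

definition matrix_scale :: "'a::times \<Rightarrow> 'a^'n^'m \<Rightarrow> 'a^'n^'m"  (infixr \<open>*\<^sub>k\<close> 75)
  where "c *\<^sub>k A = (\<chi> i j. c * A $ i $ j)"

definition commutator :: "'a::ring_1^'n^'n \<Rightarrow> 'a^'n^'n \<Rightarrow> 'a^'n^'n"
  where "commutator X Y = X ** Y - Y ** X"

text \<open>The block matrix with first block row \<open>A, B\<close> and second block row \<open>C, D\<close>.
  Rows and columns are indexed by sum types; with \<open>2 \<times> 2\<close> blocks the index type
  \<open>2 + 2\<close> has four elements.\<close>

definition block_matrix ::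
    "'a^'n^'m \<Rightarrow> 'a^'p^'m \<Rightarrow> 'a^'n^'q \<Rightarrow> 'a^'p^'q \<Rightarrow> 'a^('n + 'p)^('m + 'q)"
  where "block_matrix A B C D = (\<chi> i j.
     case i of
       Inl r \<Rightarrow> (case j of Inl s \<Rightarrow> A $ r $ s | Inr s \<Rightarrow> B $ r $ s)
     | Inr r \<Rightarrow> (case j of Inl s \<Rightarrow> C $ r $ s | Inr s \<Rightarrow> D $ r $ s))"

text \<open>The matrix with real rows \<open>(a, b)\<close> and \<open>(c, d)\<close>, regarded as a complex matrix.\<close>

definition cmat2 :: "real \<Rightarrow> real \<Rightarrow> real \<Rightarrow> real \<Rightarrow> complex^2^2"
  where "cmat2 a b c d =
    vector [vector [complex_of_real a, complex_of_real b],
            vector [complex_of_real c, complex_of_real d]]"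

text \<open>The Baker--Campbell--Hausdorff series of \<open>log (exp X exp Y)\<close> up to double
  commutators. For \<open>log (exp (i h B) exp (i h A)) / (i h)\<close> it yields the expansion below,
  which is the one that defines the effective matrix.\<close>

definition bch2 :: "complex^'n^'n \<Rightarrow> complex^'n^'n \<Rightarrow> complex^'n^'n"
  where "bch2 X Y = X + Y + (1/2) *\<^sub>R commutator X Y
      + (1/12) *\<^sub>R commutator X (commutator X Y) - (1/12) *\<^sub>R commutator Y (commutator X Y)"

lemma commutator_scale:
  fixes X Y :: "complex^'n^'n"
  shows "commutator (a *\<^sub>k X) (b *\<^sub>k Y) = (a * b) *\<^sub>k commutator X Y"
  by (simp add: commutator_def matrix_scale_def matrix_matrix_mult_def vec_eq_iff
      sum_distrib_left right_diff_distrib mult_ac)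

lemma matrix_scale_scale:
  fixes X :: "complex^'n^'m"
  shows "a *\<^sub>k b *\<^sub>k X = (a * b) *\<^sub>k X"
  by (simp add: matrix_scale_def vec_eq_iff mult_ac)

lemma scaleR_matrix_scale:
  fixes X :: "complex^'n^'m"
  shows "r *\<^sub>R X = complex_of_real r *\<^sub>k X"
  by (simp add: matrix_scale_def vec_eq_iff scaleR_conv_of_real [where 'a = complex])

lemma bch2_expansion:
  fixes A B :: "complex^'n^'n" and h :: real
  assumes "h \<noteq> 0"
  shows "(1 / (\<i> * h)) *\<^sub>k bch2 ((\<i> * h) *\<^sub>k B) ((\<i> * h) *\<^sub>k A) =
    A + B + (\<i> * h / 2) *\<^sub>k commutator B A
      + (h\<^sup>2 / 12) *\<^sub>R commutator A (commutator B A)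
      - (h\<^sup>2 / 12) *\<^sub>R commutator B (commutator B A)"
  unfolding bch2_def commutator_scale scaleR_matrix_scale matrix_scale_scale
  using assms
  by (simp add: matrix_scale_def vec_eq_iff field_simps power2_eq_square)

end

theory Submission
  imports Defs
begin

text \<open>Each layer matrix is block off-diagonal with antidiagonal \<open>2 \<times> 2\<close>
  blocks. With respect to the block grading, the product of two off-diagonal matrices is diagonal,
  and a diagonal times an off-diagonal matrix is off-diagonal. Hence the single commutator, the only
  term with a factor \<open>\<i>\<close>, fills exactly the diagonal blocks and yields the
  magnetoelectric coupling. The double commutators only correct the off-diagonal blocks, that is,
  the permittivities and permeabilities. The commutator depends on just two real numbers
  \<open>p\<close> and \<open>q\<close>, and \<open>bch_block_antidiagonal\<close> expresses the
  whole expansion through them. For the two layers \<open>p = g * \<gamma>\<close> and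
  \<open>q = - g\<close>, with \<open>g\<close> proportional to
  \<open>\<epsilon>\<^sub>1 - \<epsilon>\<^sub>2\<close>. This explains where
  \<open>\<gamma>\<close> occurs: in the entries governed by \<open>p\<close> and in no others. What
  remains is scalar algebra.\<close>

lemma block_matrix_add:
  "block_matrix A B C D + block_matrix A' B' C' D' =
    block_matrix (A + A') (B + B') (C + C') (D + D')"
  by (simp add: block_matrix_def vec_eq_iff split: sum.split)

lemma block_matrix_diff:
  fixes A A' :: "'a::group_add^'n^'m"
  shows "block_matrix A B C D - block_matrix A' B' C' D' =
    block_matrix (A - A') (B - B') (C - C') (D - D')"
  by (simp add: block_matrix_def vec_eq_iff split: sum.split)

lemma block_matrix_scaleR:
  "c *\<^sub>R block_matrix A B C D = block_matrix (c *\<^sub>R A) (c *\<^sub>R B) (c *\<^sub>R C) (c *\<^sub>R D)"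
  by (simp add: block_matrix_def vec_eq_iff split: sum.split)

lemma block_matrix_scale:
  "c *\<^sub>k block_matrix A B C D = block_matrix (c *\<^sub>k A) (c *\<^sub>k B) (c *\<^sub>k C) (c *\<^sub>k D)"
  by (simp add: matrix_scale_def block_matrix_def vec_eq_iff split: sum.split)

text \<open>Splits the inner sum of a matrix product along the block structure of the index type,
  which is what \<open>block_matrix_mult\<close> rests on.\<close>

lemma sum_UNIV_sum_type:
  fixes f :: "'a::finite + 'b::finite \<Rightarrow> 'c::comm_monoid_add"
  shows "sum f UNIV = (\<Sum>x\<in>UNIV. f (Inl x)) + (\<Sum>y\<in>UNIV. f (Inr y))"
  unfolding UNIV_Plus_UNIV [symmetric] by (subst sum.Plus) simp_all

lemma block_matrix_mult:
  fixes A :: "'a::semiring_1^'n^'m"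
  shows "block_matrix A B C D ** block_matrix A' B' C' D' =
    block_matrix (A ** A' + B ** C') (A ** B' + B ** D')
                 (C ** A' + D ** C') (C ** B' + D ** D')"
  by (simp add: block_matrix_def matrix_matrix_mult_def vec_eq_iff sum_UNIV_sum_type
      split: sum.split)

lemma cmat2_add: "cmat2 a b c d + cmat2 a' b' c' d' = cmat2 (a + a') (b + b') (c + c') (d + d')"
  by (simp add: cmat2_def vec_eq_iff forall_2)

lemma cmat2_diff: "cmat2 a b c d - cmat2 a' b' c' d' = cmat2 (a - a') (b - b') (c - c') (d - d')"
  by (simp add: cmat2_def vec_eq_iff forall_2)

lemma cmat2_uminus: "- cmat2 a b c d = cmat2 (- a) (- b) (- c) (- d)"
  by (simp add: cmat2_def vec_eq_iff forall_2)

lemma cmat2_scaleR: "x *\<^sub>R cmat2 a b c d = cmat2 (x * a) (x * b) (x * c) (x * d)"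
  by (simp add: cmat2_def vec_eq_iff forall_2 scaleR_conv_of_real [where 'a = complex])

lemma cmat2_mult:
  "cmat2 a b c d ** cmat2 a' b' c' d' =
    cmat2 (a * a' + b * c') (a * b' + b * d') (c * a' + d * c') (c * b' + d * d')"
  by (simp add: cmat2_def matrix_matrix_mult_def vec_eq_iff forall_2 sum_2)

lemma mat_1_eq_cmat2: "mat 1 = cmat2 1 0 0 1"
  by (simp add: cmat2_def mat_def vec_eq_iff forall_2)

text \<open>\<open>matrix_inv\<close> is a choice of some two-sided inverse; \<open>B\<close>
  witnesses that one exists, and associativity forces the chosen one to equal
  \<open>B\<close>.\<close>

lemma matrix_inv_unique:
  fixes A :: "'a::semiring_1^'n^'m"
  assumes "A ** B = mat 1" and "B ** A = mat 1"
  shows "matrix_inv A = B"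
proof -
  have "A ** matrix_inv A = mat 1 \<and> matrix_inv A ** A = mat 1"
    unfolding matrix_inv_def by (rule someI [of _ B]) (use assms in blast)
  then show ?thesis
    by (metis assms(1) matrix_mul_assoc matrix_mul_lid matrix_mul_rid)
qed

lemma matrix_inv_cmat2_antidiagonal:
  assumes "b \<noteq> 0" and "c \<noteq> 0"
  shows "matrix_inv (cmat2 0 b c 0) = cmat2 0 (inverse c) (inverse b) 0"
  by (rule matrix_inv_unique) (use assms in \<open>simp_all add: cmat2_mult mat_1_eq_cmat2\<close>)

text \<open>Together with \<open>commutator_offdiag_diag\<close> this is the grading rule: odd with
  odd gives even, odd with even gives odd.\<close>

lemma commutator_offdiag_offdiag:
  fixes B C B' C' :: "'a::ring_1^'n^'n"
  shows "commutator (block_matrix 0 B C 0) (block_matrix 0 B' C' 0) =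
    block_matrix (B ** C' - B' ** C) 0 0 (C ** B' - C' ** B)"
  by (simp add: commutator_def block_matrix_mult block_matrix_diff)

lemma commutator_offdiag_diag:
  fixes B C P Q :: "'a::ring_1^'n^'n"
  shows "commutator (block_matrix 0 B C 0) (block_matrix P 0 0 Q) =
    block_matrix 0 (B ** Q - P ** B) (C ** P - Q ** C) 0"
  by (simp add: commutator_def block_matrix_mult block_matrix_diff)

text \<open>Since \<open>\<i>\<close> only multiplies the single commutator, which is block diagonal, while the
  remaining terms are block off-diagonal, all entries can be computed over the reals.\<close>

lemma bch_block_antidiagonal:
  fixes h a b c d a' b' c' d' :: real
  defines "A \<equiv> block_matrix 0 (cmat2 0 a b 0) (cmat2 0 c d 0) 0"
    and "B \<equiv> block_matrix 0 (cmat2 0 a' b' 0) (cmat2 0 c' d' 0) 0"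
    and "p \<equiv> a' * d - a * d'" and "q \<equiv> b' * c - b * c'"
  shows "A + B + (\<i> * complex_of_real h / 2) *\<^sub>k commutator B A
      + (h\<^sup>2 / 12) *\<^sub>R commutator A (commutator B A)
      - (h\<^sup>2 / 12) *\<^sub>R commutator B (commutator B A) =
    block_matrix
      (\<i> *\<^sub>k cmat2 (h / 2 * p) 0 0 (h / 2 * q))
      (cmat2 0 (a + a' + h\<^sup>2 / 6 * (a' - a) * p) (b + b' + h\<^sup>2 / 6 * (b' - b) * q) 0)
      (cmat2 0 (c + c' + h\<^sup>2 / 6 * (c - c') * q) (d + d' + h\<^sup>2 / 6 * (d - d') * p) 0)
      (\<i> *\<^sub>k cmat2 (- h / 2 * q) 0 0 (- h / 2 * p))"
proof -
  \<comment> \<open>The lower block is the upper one negated and with its entries swapped. In a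
    further commutator with \<open>A\<close> or \<open>B\<close> the two products therefore add up
    instead of cancelling, and this factor 2 turns \<open>h\<^sup>2 / 12\<close> into
    \<open>h\<^sup>2 / 6\<close>.\<close>
  have comm: "commutator B A = block_matrix (cmat2 p 0 0 q) 0 0 (cmat2 (- q) 0 0 (- p))"
    by (simp add: A_def B_def p_def q_def commutator_offdiag_offdiag cmat2_mult cmat2_diff
        algebra_simps)
  show ?thesis
    unfolding comm unfolding A_def B_def
    by (simp add: commutator_offdiag_diag block_matrix_add block_matrix_diff block_matrix_scaleR
        block_matrix_scale cmat2_mult cmat2_add cmat2_diff cmat2_scaleR)
      (auto simp: block_matrix_def matrix_scale_def cmat2_def vec_eq_iff forall_2 field_simps
        split: sum.split)
qed

theorem mainTheorem4:
  fixes \<epsilon>\<^sub>1 \<epsilon>\<^sub>2 \<mu>\<^sub>0 \<omega> k h\<^sub>1 h\<^sub>2 h f\<^sub>1 f\<^sub>2 \<gamma> :: real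
    and K_perp K_par \<epsilon>_par \<epsilon>_perp \<mu>_par \<mu>_perp \<epsilon>3_inv \<mu>3_inv :: real
    and \<sigma>\<^sub>1 \<sigma>\<^sub>2 \<sigma>_par \<sigma>_perp \<sigma>3_inv \<sigma>_K \<sigma>_K' :: "complex^2^2"
    and M\<^sub>1 M\<^sub>2 M_eff :: "complex^(2 + 2)^(2 + 2)"
  assumes "\<epsilon>\<^sub>1 > 0" and "\<epsilon>\<^sub>2 > 0" and "\<mu>\<^sub>0 > 0" and "\<omega> > 0" and "h\<^sub>1 > 0" and "h\<^sub>2 > 0"
    and "h = h\<^sub>1 + h\<^sub>2" and "f\<^sub>1 = h\<^sub>1 / h" and "f\<^sub>2 = h\<^sub>2 / h"
    and "\<sigma>\<^sub>1 = cmat2 0 \<mu>\<^sub>0 (- \<epsilon>\<^sub>1) 0"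
    and "\<sigma>\<^sub>2 = cmat2 0 \<mu>\<^sub>0 (- \<epsilon>\<^sub>2) 0"
    and "M\<^sub>1 = \<omega> *\<^sub>R block_matrix 0 (\<sigma>\<^sub>1 + (k\<^sup>2 / \<omega>\<^sup>2) *\<^sub>R matrix_inv \<sigma>\<^sub>1) (- \<sigma>\<^sub>1) 0"
    and "M\<^sub>2 = \<omega> *\<^sub>R block_matrix 0 (\<sigma>\<^sub>2 + (k\<^sup>2 / \<omega>\<^sup>2) *\<^sub>R matrix_inv \<sigma>\<^sub>2) (- \<sigma>\<^sub>2) 0"
    and "M_eff = f\<^sub>1 *\<^sub>R M\<^sub>1 + f\<^sub>2 *\<^sub>R M\<^sub>2
      + (\<i> * complex_of_real h / 2) *\<^sub>k commutator (f\<^sub>2 *\<^sub>R M\<^sub>2) (f\<^sub>1 *\<^sub>R M\<^sub>1)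
      + (h\<^sup>2 / 12) *\<^sub>R commutator (f\<^sub>1 *\<^sub>R M\<^sub>1) (commutator (f\<^sub>2 *\<^sub>R M\<^sub>2) (f\<^sub>1 *\<^sub>R M\<^sub>1))
      - (h\<^sup>2 / 12) *\<^sub>R commutator (f\<^sub>2 *\<^sub>R M\<^sub>2) (commutator (f\<^sub>2 *\<^sub>R M\<^sub>2) (f\<^sub>1 *\<^sub>R M\<^sub>1))"
    and "\<gamma> = 1 - k\<^sup>2 / \<omega>\<^sup>2 * ((\<epsilon>\<^sub>1 + \<epsilon>\<^sub>2) / (\<mu>\<^sub>0 * \<epsilon>\<^sub>1 * \<epsilon>\<^sub>2))"
    and "K_perp = \<omega> * h / 2 * \<mu>\<^sub>0 * (\<epsilon>\<^sub>1 - \<epsilon>\<^sub>2) * f\<^sub>1 * f\<^sub>2"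
    and "K_par = \<omega> * h / 2 * \<mu>\<^sub>0 * (\<epsilon>\<^sub>1 - \<epsilon>\<^sub>2) * f\<^sub>1 * f\<^sub>2 * \<gamma>"
    and "\<epsilon>_par = \<epsilon>\<^sub>1 * f\<^sub>1 + \<epsilon>\<^sub>2 * f\<^sub>2
      + \<omega>\<^sup>2 * h\<^sup>2 / 6 * \<mu>\<^sub>0 * f\<^sub>1 * f\<^sub>2 * (\<epsilon>\<^sub>1 - \<epsilon>\<^sub>2) * (\<epsilon>\<^sub>1 * f\<^sub>1 - \<epsilon>\<^sub>2 * f\<^sub>2) * \<gamma>"
    and "\<epsilon>_perp = \<epsilon>\<^sub>1 * f\<^sub>1 + \<epsilon>\<^sub>2 * f\<^sub>2
      + \<omega>\<^sup>2 * h\<^sup>2 / 6 * \<mu>\<^sub>0 * f\<^sub>1 * f\<^sub>2 * (\<epsilon>\<^sub>1 - \<epsilon>\<^sub>2) * (\<epsilon>\<^sub>1 * f\<^sub>1 - \<epsilon>\<^sub>2 * f\<^sub>2)"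
    and "\<mu>_par = \<mu>\<^sub>0 - \<omega>\<^sup>2 * h\<^sup>2 / 6 * \<mu>\<^sub>0\<^sup>2 * f\<^sub>1 * f\<^sub>2 * (\<epsilon>\<^sub>1 - \<epsilon>\<^sub>2) * (f\<^sub>1 - f\<^sub>2)"
    and "\<mu>_perp = \<mu>\<^sub>0 - \<omega>\<^sup>2 * h\<^sup>2 / 6 * \<mu>\<^sub>0\<^sup>2 * f\<^sub>1 * f\<^sub>2 * (\<epsilon>\<^sub>1 - \<epsilon>\<^sub>2) * (f\<^sub>1 - f\<^sub>2) * \<gamma>"
    and "\<epsilon>3_inv = inverse \<epsilon>\<^sub>1 * f\<^sub>1 + inverse \<epsilon>\<^sub>2 * f\<^sub>2
      - \<omega>\<^sup>2 * h\<^sup>2 / 6 * \<mu>\<^sub>0 * f\<^sub>1 * f\<^sub>2 * (\<epsilon>\<^sub>1 - \<epsilon>\<^sub>2) * (inverse \<epsilon>\<^sub>1 * f\<^sub>1 - inverse \<epsilon>\<^sub>2 * f\<^sub>2) * \<gamma>"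
    and "\<mu>3_inv = inverse \<mu>\<^sub>0 + \<omega>\<^sup>2 * h\<^sup>2 / 6 * f\<^sub>1 * f\<^sub>2 * (\<epsilon>\<^sub>1 - \<epsilon>\<^sub>2) * (f\<^sub>1 - f\<^sub>2)"
    and "\<sigma>_par = cmat2 0 \<mu>_par (- \<epsilon>_par) 0"
    and "\<sigma>_perp = cmat2 0 \<mu>_perp (- \<epsilon>_perp) 0"
    and "\<sigma>3_inv = cmat2 0 (- \<epsilon>3_inv) \<mu>3_inv 0"
    and "\<sigma>_K = cmat2 K_perp 0 0 (- K_par)"
    and "\<sigma>_K' = cmat2 (- K_par) 0 0 K_perp"
  shows "M_eff = \<omega> *\<^sub>R block_matrix
      (- \<i> *\<^sub>k \<sigma>_K') (\<sigma>_perp + (k\<^sup>2 / \<omega>\<^sup>2) *\<^sub>R \<sigma>3_inv)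
      (- \<sigma>_par)      (\<i> *\<^sub>k \<sigma>_K)"
proof -
  define r where "r = k\<^sup>2 / \<omega>\<^sup>2"
  \<comment> \<open>The nonzero entries of \<open>f\<^sub>1 *\<^sub>R M\<^sub>1\<close>: the terms
    with \<open>r\<close> come from the inverse of \<open>\<sigma>\<^sub>1\<close>, which is again
    antidiagonal.\<close>
  define a\<^sub>1 b\<^sub>1 c\<^sub>1 d\<^sub>1 where "a\<^sub>1 = f\<^sub>1 * \<omega> * (\<mu>\<^sub>0 - r * inverse \<epsilon>\<^sub>1)" and "b\<^sub>1 = f\<^sub>1 * \<omega> * (r * inverse \<mu>\<^sub>0 - \<epsilon>\<^sub>1)"
    and "c\<^sub>1 = - f\<^sub>1 * \<omega> * \<mu>\<^sub>0" and "d\<^sub>1 = f\<^sub>1 * \<omega> * \<epsilon>\<^sub>1"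
  note defs1 = this
  define a\<^sub>2 b\<^sub>2 c\<^sub>2 d\<^sub>2 where "a\<^sub>2 = f\<^sub>2 * \<omega> * (\<mu>\<^sub>0 - r * inverse \<epsilon>\<^sub>2)" and "b\<^sub>2 = f\<^sub>2 * \<omega> * (r * inverse \<mu>\<^sub>0 - \<epsilon>\<^sub>2)"
    and "c\<^sub>2 = - f\<^sub>2 * \<omega> * \<mu>\<^sub>0" and "d\<^sub>2 = f\<^sub>2 * \<omega> * \<epsilon>\<^sub>2"
  note defs2 = this
  have nz: "\<epsilon>\<^sub>1 \<noteq> 0" "\<epsilon>\<^sub>2 \<noteq> 0" "\<mu>\<^sub>0 \<noteq> 0" "\<omega> \<noteq> 0"
    using assms(1-4) by simp_all
  have "f\<^sub>1 + f\<^sub>2 = 1"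
    using assms(5-9) by (simp add: add_divide_distrib [symmetric])
  \<comment> \<open>Eliminating \<open>f\<^sub>2\<close> lets the averages of the common
    permeability and of its inverse collapse to \<open>\<mu>\<^sub>0\<close> and
    \<open>inverse \<mu>\<^sub>0\<close>.\<close>
  then have f\<^sub>2: "f\<^sub>2 = 1 - f\<^sub>1"
    by simp
  have M\<^sub>1: "f\<^sub>1 *\<^sub>R M\<^sub>1 = block_matrix 0 (cmat2 0 a\<^sub>1 b\<^sub>1 0) (cmat2 0 c\<^sub>1 d\<^sub>1 0) 0"
    using nz unfolding assms(10,12)
    by (simp add: matrix_inv_cmat2_antidiagonal block_matrix_scaleR cmat2_add cmat2_uminus
        cmat2_scaleR defs1 r_def mult.assoc)
  have M\<^sub>2: "f\<^sub>2 *\<^sub>R M\<^sub>2 = block_matrix 0 (cmat2 0 a\<^sub>2 b\<^sub>2 0) (cmat2 0 c\<^sub>2 d\<^sub>2 0) 0"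
    using nz unfolding assms(11,13)
    by (simp add: matrix_inv_cmat2_antidiagonal block_matrix_scaleR cmat2_add cmat2_uminus
        cmat2_scaleR defs2 r_def mult.assoc)
  define g where "g = \<omega>\<^sup>2 * f\<^sub>1 * f\<^sub>2 * \<mu>\<^sub>0 * (\<epsilon>\<^sub>1 - \<epsilon>\<^sub>2)"
  \<comment> \<open>The part with \<open>r\<close> contains \<open>\<epsilon>\<^sub>1 /
    \<epsilon>\<^sub>2 - \<epsilon>\<^sub>2 / \<epsilon>\<^sub>1\<close>, which has the factor
    \<open>(\<epsilon>\<^sub>1 - \<epsilon>\<^sub>2) * (\<epsilon>\<^sub>1 +
    \<epsilon>\<^sub>2)\<close>; pulling out \<open>g\<close> leaves
    \<open>\<gamma>\<close>.\<close>
  have p: "a\<^sub>2 * d\<^sub>1 - a\<^sub>1 * d\<^sub>2 = g * \<gamma>"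
    unfolding defs1 defs2 g_def assms(15) r_def [symmetric]
    using nz by (simp add: field_simps power2_eq_square)
  \<comment> \<open>Here the terms with \<open>r\<close> cancel because both layers have the same
    permeability, so no \<open>\<gamma>\<close> arises.\<close>
  have q: "b\<^sub>2 * c\<^sub>1 - b\<^sub>1 * c\<^sub>2 = - g"
    unfolding defs1 defs2 g_def using nz by (simp add: field_simps power2_eq_square)
  note entries = bch_block_antidiagonal [of a\<^sub>1 b\<^sub>1 c\<^sub>1 d\<^sub>1 a\<^sub>2 b\<^sub>2 c\<^sub>2 d\<^sub>2 h, folded M\<^sub>1 M\<^sub>2, unfolded p q]
  have K: "h / 2 * (g * \<gamma>) = \<omega> * K_par" "h / 2 * - g = - \<omega> * K_perp"
    unfolding assms(16,17) g_def by (simp_all add: power2_eq_square)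
  \<comment> \<open>Although \<open>\<gamma>\<close> depends on \<open>r\<close>, it is kept opaque:
    the terms without explicit \<open>r\<close> give \<open>\<mu>_perp\<close> and
    \<open>\<epsilon>_perp\<close>, those linear in it give \<open>\<epsilon>3_inv\<close> and
    \<open>\<mu>3_inv\<close>.\<close>
  have upper: "a\<^sub>1 + a\<^sub>2 + h\<^sup>2 / 6 * (a\<^sub>2 - a\<^sub>1) * (g * \<gamma>) = \<omega> * (\<mu>_perp - r * \<epsilon>3_inv)"
    "b\<^sub>1 + b\<^sub>2 + h\<^sup>2 / 6 * (b\<^sub>2 - b\<^sub>1) * - g = \<omega> * (r * \<mu>3_inv - \<epsilon>_perp)"
    unfolding defs1 defs2 g_def assms(19,21,22,23) f\<^sub>2
    using nz by (simp_all add: field_simps power2_eq_square)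
  have lower: "c\<^sub>1 + c\<^sub>2 + h\<^sup>2 / 6 * (c\<^sub>1 - c\<^sub>2) * - g = - \<omega> * \<mu>_par"
    "d\<^sub>1 + d\<^sub>2 + h\<^sup>2 / 6 * (d\<^sub>1 - d\<^sub>2) * (g * \<gamma>) = \<omega> * \<epsilon>_par"
    unfolding defs1 defs2 g_def assms(18,20) f\<^sub>2
    by (simp_all add: field_simps power2_eq_square)
  have "M_eff = block_matrix
      (\<i> *\<^sub>k cmat2 (\<omega> * K_par) 0 0 (- \<omega> * K_perp))
      (cmat2 0 (\<omega> * (\<mu>_perp - r * \<epsilon>3_inv)) (\<omega> * (r * \<mu>3_inv - \<epsilon>_perp)) 0)
      (cmat2 0 (- \<omega> * \<mu>_par) (\<omega> * \<epsilon>_par) 0)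
      (\<i> *\<^sub>k cmat2 (\<omega> * K_perp) 0 0 (- \<omega> * K_par))"
    \<comment> \<open>\<open>K\<close> serves twice: as a rewrite rule for the upper diagonal block,
      and as a fact for the lower one, whose factor \<open>- h / 2\<close> the rewrite rule does not
      match.\<close>
    unfolding assms(14) entries upper lower K using K by simp
  then show ?thesis
    unfolding assms(24-28) r_def
    by (simp add: block_matrix_scaleR cmat2_add cmat2_uminus cmat2_scaleR)
      (auto simp: block_matrix_def matrix_scale_def cmat2_def vec_eq_iff forall_2
        scaleR_conv_of_real [where 'a = complex] split: sum.split)
qed

end
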